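(* Let $n\geqslant 3$ be an integer and let $S\subset[0,\infty)$ be a set with $|S|=n$ and $0\in S$. Then the number of spaces $X\in\mathfrak{U}_n$ with $\operatorname{Sp}(X)=S$, counted up to isometry, equals $$\sum_{k=2}^{n-1}C_{n-3}^{k-2}\,\kappa(\mathfrak{U}_k)\,\kappa(\mathfrak{U}_{n-k}),$$ where $\kappa(\mathfrak{U}_1)=\kappa(\mathfrak{U}_2)=1$ and $C_{n-3}^{k-2}=\frac{(n-3)!}{(k-2)!\,(n-k-1)!}$.
   Context: An ultrametric on a set $X$ is a function $d\colon X\times X\to[0,\infty)$ such that $d(x,y)=d(y,x)$, $d(x,y)=0\Leftrightarrow x=y$, and $d(x,y)\leqslant\max\{d(x,z),d(z,y)\}$ for all $x,y,z\in X$. For a metric space $(X,d)$, the spectrum is $\operatorname{Sp}(X)=\{d(x,y)\colon x,y\in X\}$. $\mathfrak{U}$ is the class of finite ultrametric spaces $X$ with $|\operatorname{Sp}(X)|=|X|$, and $\mathfrak{U}_n=\{X\in\mathfrak{U}\colon|X|=n\}$ for integers $n\geqslant 1$. For metric spaces $(X,d_X)$ and $(Y,d_Y)$, a bijective mapping $\Phi\colon X\to Y$ is a weak similarity if there is a strictly increasing bijective function $f\colon\operatorname{Sp}(Y)\to\operatorname{Sp}(X)$ such that $d_X(x,y)=f(d_Y(\Phi(x),\Phi(y)))$ for all $x,y\in X$; one writes $X\simeq Y$ if a weak similarity exists (an equivalence relation). $\kappa(\mathfrak{U}_n):=\operatorname{card}(\mathfrak{U}_n/\simeq)$ is the number of weak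 similarity classes in $\mathfrak{U}_n$. *)

theory Defs
  imports "HOL-Analysis.Analysis" "HOL-Library.Infinite_Typeclass"
begin

text \<open>The type \<^typ>\<open>'a metric\<close> consists of the metric spaces whose points lie in \<^typ>\<open>'a\<close>.
  Symmetry, definiteness and nonnegativity of the distance are part of that type.\<close>

definition ultrametric :: "'a metric \<Rightarrow> bool" where
  "ultrametric X \<longleftrightarrow>
     (\<forall>x\<in>mspace X. \<forall>y\<in>mspace X. \<forall>z\<in>mspace X. mdist X x y \<le> max (mdist X x z) (mdist X z y))"

definition spectrum :: "'a metric \<Rightarrow> real set" where
  "spectrum X = {mdist X x y | x y. x \<in> mspace X \<and> y \<in> mspace X}"

definition isometric :: "'a metric \<Rightarrow> 'b metric \<Rightarrow> bool" where
  "isometric X Y \<longleftrightarrow> (\<exists>\<Phi>. bij_betw \<Phi> (mspace X) (mspace Y) \<and>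
     (\<forall>x\<in>mspace X. \<forall>y\<in>mspace X. mdist X x y = mdist Y (\<Phi> x) (\<Phi> y)))"

definition weakly_similar :: "'a metric \<Rightarrow> 'b metric \<Rightarrow> bool" where
  "weakly_similar X Y \<longleftrightarrow> (\<exists>\<Phi> f. bij_betw \<Phi> (mspace X) (mspace Y) \<and>
     bij_betw f (spectrum Y) (spectrum X) \<and> strict_mono_on (spectrum Y) f \<and>
     (\<forall>x\<in>mspace X. \<forall>y\<in>mspace X. mdist X x y = f (mdist Y (\<Phi> x) (\<Phi> y))))"

definition \<UU> :: "'a metric set" where
  "\<UU> =
     {X. finite (mspace X) \<and> ultrametric X \<and> card (spectrum X) = card (mspace X)}"

definition \<UU>_card :: "nat \<Rightarrow> 'a metric set" where
  "\<UU>_card n = {X \<in> \<UU>. card (mspace X) = n}"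

definition isometry_rel :: "'a metric set \<Rightarrow> ('a metric \<times> 'a metric) set" where
  "isometry_rel A = {(X, Y). X \<in> A \<and> Y \<in> A \<and> isometric X Y}"

definition weak_similarity_rel :: "'a metric set \<Rightarrow> ('a metric \<times> 'a metric) set" where
  "weak_similarity_rel A = {(X, Y). X \<in> A \<and> Y \<in> A \<and> weakly_similar X Y}"

text \<open>There is no type of all metric spaces, so classes are formed among the spaces with points in a
  fixed type \<^typ>\<open>'a\<close>. When \<^typ>\<open>'a\<close> is infinite, every finite metric space is isometric to one of
  these, hence no class is lost.\<close>

definition kappa :: "'a::infinite itself \<Rightarrow> nat \<Rightarrow> nat" where
  "kappa (_ :: 'a itself) n = card ((\<UU>_card n :: 'a metric set) // weak_similarity_rel (\<UU>_card n))"

lemma isometric_refl: "isometric X X"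
  unfolding isometric_def by (rule exI[of _ id]) auto

lemma isometric_sym:
  assumes "isometric X Y"
  shows "isometric Y X"
proof -
  obtain \<Phi> where b: "bij_betw \<Phi> (mspace X) (mspace Y)"
    and d: "\<forall>x\<in>mspace X. \<forall>y\<in>mspace X. mdist X x y = mdist Y (\<Phi> x) (\<Phi> y)"
    using assms unfolding isometric_def by blast
  let ?\<Psi> = "the_inv_into (mspace X) \<Phi>"
  have "bij_betw ?\<Psi> (mspace Y) (mspace X)"
    using b by (rule bij_betw_the_inv_into)
  moreover have "mdist Y x y = mdist X (?\<Psi> x) (?\<Psi> y)" if "x \<in> mspace Y" "y \<in> mspace Y" for x y
    using that d bij_betw_apply[OF calculation] by (simp add: f_the_inv_into_f_bij_betw[OF b])
  ultimately show ?thesis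
    unfolding isometric_def by blast
qed

lemma isometric_trans:
  assumes "isometric X Y" "isometric Y Z"
  shows "isometric X Z"
proof -
  obtain \<Phi> \<Psi> where b: "bij_betw \<Phi> (mspace X) (mspace Y)" "bij_betw \<Psi> (mspace Y) (mspace Z)"
    and d: "\<forall>x\<in>mspace X. \<forall>y\<in>mspace X. mdist X x y = mdist Y (\<Phi> x) (\<Phi> y)"
      "\<forall>x\<in>mspace Y. \<forall>y\<in>mspace Y. mdist Y x y = mdist Z (\<Psi> x) (\<Psi> y)"
    using assms unfolding isometric_def by blast
  show ?thesis
    unfolding isometric_def
    using bij_betw_trans[OF b] d bij_betw_apply[OF b(1)] by (intro exI[of _ "\<Psi> \<circ> \<Phi>"]) simp
qed

lemma equiv_isometry_rel: "equiv A (isometry_rel A)"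
  by (intro equivI refl_onI symI transI)
    (auto simp: isometry_rel_def isometric_refl intro: isometric_sym isometric_trans)

lemma weakly_similar_refl: "weakly_similar X X"
  unfolding weakly_similar_def
  by (rule exI[of _ id], rule exI[of _ id]) (auto simp: strict_mono_on_def)

lemma mdist_in_spectrum: "x \<in> mspace X \<Longrightarrow> y \<in> mspace X \<Longrightarrow> mdist X x y \<in> spectrum X"
  unfolding spectrum_def by blast

lemma weakly_similar_sym:
  assumes "weakly_similar X Y"
  shows "weakly_similar Y X"
proof -
  obtain \<Phi> f where b: "bij_betw \<Phi> (mspace X) (mspace Y)"
    and f: "bij_betw f (spectrum Y) (spectrum X)" "strict_mono_on (spectrum Y) f"
    and d: "\<forall>x\<in>mspace X. \<forall>y\<in>mspace X. mdist X x y = f (mdist Y (\<Phi> x) (\<Phi> y))"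
    using assms unfolding weakly_similar_def by blast
  let ?\<Psi> = "the_inv_into (mspace X) \<Phi>" and ?g = "the_inv_into (spectrum Y) f"
  have b': "bij_betw ?\<Psi> (mspace Y) (mspace X)"
    using b by (rule bij_betw_the_inv_into)
  have g: "bij_betw ?g (spectrum X) (spectrum Y)"
    using f(1) by (rule bij_betw_the_inv_into)
  have "?g r < ?g s" if "r \<in> spectrum X" "s \<in> spectrum X" "r < s" for r s
  proof (rule ccontr)
    assume "\<not> ?g r < ?g s"
    then have "f (?g s) \<le> f (?g r)"
      using strict_mono_onD[OF f(2) bij_betw_apply[OF g that(2)] bij_betw_apply[OF g that(1)]]
      by (cases "?g s = ?g r") auto
    then show False
      using that by (simp add: f_the_inv_into_f_bij_betw[OF f(1)])
  qed
  then have m: "strict_mono_on (spectrum X) ?g"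
    by (simp add: strict_mono_on_def)
  have "mdist Y x y = ?g (mdist X (?\<Psi> x) (?\<Psi> y))" if "x \<in> mspace Y" "y \<in> mspace Y" for x y
  proof -
    have "mdist X (?\<Psi> x) (?\<Psi> y) = f (mdist Y x y)"
      using that d bij_betw_apply[OF b'] by (simp add: f_the_inv_into_f_bij_betw[OF b])
    then show ?thesis
      using f(1) mdist_in_spectrum[OF that] by (simp add: bij_betw_def the_inv_into_f_f)
  qed
  then show ?thesis
    unfolding weakly_similar_def using b' g m by blast
qed

lemma weakly_similar_trans:
  assumes "weakly_similar X Y" "weakly_similar Y Z"
  shows "weakly_similar X Z"
proof -
  obtain \<Phi> f where 1: "bij_betw \<Phi> (mspace X) (mspace Y)"
      "bij_betw f (spectrum Y) (spectrum X)" "strict_mono_on (spectrum Y) f"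
      "\<forall>x\<in>mspace X. \<forall>y\<in>mspace X. mdist X x y = f (mdist Y (\<Phi> x) (\<Phi> y))"
    using assms(1) unfolding weakly_similar_def by blast
  obtain \<Psi> g where 2: "bij_betw \<Psi> (mspace Y) (mspace Z)"
      "bij_betw g (spectrum Z) (spectrum Y)" "strict_mono_on (spectrum Z) g"
      "\<forall>x\<in>mspace Y. \<forall>y\<in>mspace Y. mdist Y x y = g (mdist Z (\<Psi> x) (\<Psi> y))"
    using assms(2) unfolding weakly_similar_def by blast
  have "strict_mono_on (spectrum Z) (f \<circ> g)"
    using 1(3) 2(3) bij_betw_apply[OF 2(2)] by (simp add: strict_mono_on_def)
  then show ?thesis
    unfolding weakly_similar_def
    using bij_betw_trans[OF 1(1) 2(1)] bij_betw_trans[OF 2(2) 1(2)] 1(4) 2(4) bij_betw_apply[OF 1(1)]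
    by (intro exI[of _ "\<Psi> \<circ> \<Phi>"] exI[of _ "f \<circ> g"]) simp
qed

lemma equiv_weak_similarity_rel: "equiv A (weak_similarity_rel A)"
  by (intro equivI refl_onI symI transI)
    (auto simp: weak_similarity_rel_def weakly_similar_refl
      intro: weakly_similar_sym weakly_similar_trans)

end

theory Submission
  imports Defs
begin

text \<open>Removing the diameter \<open>D\<close> splits a space with as many distances as points into exactly two
  spaces of the same kind at constant distance \<open>D\<close>, whose spectra share only \<open>0\<close>. The part that
  realises the second largest distance \<open>s\<close> is distinguished, so no symmetry has to be divided out:
  isometry classes with spectrum \<open>S\<close> correspond to a choice of the other distances \<open>T\<close> of that part
  among the \<open>n - 3\<close> elements of \<open>S - {0, D, s}\<close> and of isometry classes for the two parts. Since an
  increasing bijection of a finite set onto itself is the identity, weak similarity and isometry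
  agree for equal spectra, and the number of isometry classes depends only on \<open>n\<close>.\<close>

section \<open>Counting equivalence classes by a complete invariant\<close>

text \<open>\<open>R\<close> acts as a complete invariant with values in \<open>C\<close>:
  reflexivity of \<open>r\<close> together with \<open>iff\<close> makes it single-valued on
  \<open>A\<close>, so a choice function \<open>g\<close> for it has the classes of \<open>r\<close>
  as its fibres. The relational form admits invariants that are described through members of classes
  instead of being computed.\<close>

lemma card_quotient_eqI:
  assumes r: "equiv A r"
    and ex1: "\<And>a. a \<in> A \<Longrightarrow> \<exists>c\<in>C. R a c"
    and ex2: "\<And>c. c \<in> C \<Longrightarrow> \<exists>a\<in>A. R a c"
    and iff: "\<And>a a' c c'. \<lbrakk>a \<in> A; a' \<in> A; c \<in> C; c' \<in> C; R a c; R a' c'\<rbrakk> \<Longrightarrow> (a, a') \<in> r \<longleftrightarrow> c = c'"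
  shows "card (A // r) = card C"
proof -
  obtain g where g: "\<And>a. a \<in> A \<Longrightarrow> g a \<in> C \<and> R a (g a)"
    using ex1 by metis
  have gi: "(a, a') \<in> r \<longleftrightarrow> g a = g a'" if "a \<in> A" "a' \<in> A" for a a'
    using iff g that by blast
  have surj: "g ` A = C"
  proof (intro subset_antisym subsetI)
    fix c assume "c \<in> C"
    then obtain a where a: "a \<in> A" "R a c" using ex2 by blast
    then have "g a = c"
      using iff[of a a "g a" c] g \<open>c \<in> C\<close> equiv_class_self[OF r] by auto
    then show "c \<in> g ` A" using a by blast
  qed (use g in auto)
  have cls: "r `` {a} = {x \<in> A. g x = g a}" if "a \<in> A" for a
    using gi[OF that] equiv_type[OF r] by auto
  have "A // r = (\<lambda>c. {x \<in> A. g x = c}) ` C"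
    unfolding surj[symmetric] quotient_def using cls by auto
  moreover have "inj_on (\<lambda>c. {x \<in> A. g x = c}) C"
    unfolding surj[symmetric] by (rule inj_onI) blast
  ultimately show ?thesis
    by (simp add: card_image)
qed

section \<open>Increasing bijections between finite linear orders\<close>

text \<open>The maximum is removed from both sets, and the bijection of the remainders is extended
  by sending one maximum to the other.\<close>

lemma ex_strict_mono_bij:
  fixes A :: "'a::linorder set" and B :: "'b::linorder set"
  assumes "finite A" "finite B" "card A = card B"
  shows "\<exists>f. bij_betw f A B \<and> strict_mono_on A f"
  using assms
proof (induction A arbitrary: B rule: finite_linorder_max_induct)
  case empty
  then show ?case by (auto simp: strict_mono_on_def bij_betw_def)
next
  case (insert b A)
  have B: "B \<noteq> {}" "finite B" and b: "b \<notin> A" using insert by auto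
  have "card A = card (B - {Max B})" using insert B b by simp
  then obtain f where f: "bij_betw f A (B - {Max B})" "strict_mono_on A f"
    using insert.IH[of "B - {Max B}"] B by auto
  let ?f = "f(b := Max B)"
  have lt: "f x < Max B" if "x \<in> A" for x
    using bij_betwE[OF f(1)] that B by (metis DiffE Max_ge le_neq_trans singletonI)
  have "bij_betw ?f A (B - {Max B})"
    using f(1) b by (subst bij_betw_cong[of _ _ f]) auto
  then have "bij_betw ?f (insert b A) (insert (Max B) (B - {Max B}))"
    using b notIn_Un_bij_betw[of b A ?f "B - {Max B}"] by simp
  moreover have "insert (Max B) (B - {Max B}) = B" using Max_in[OF B(2,1)] by blast
  moreover have "strict_mono_on (insert b A) ?f"
    using f(2) lt insert.hyps b by (fastforce simp: strict_mono_on_def)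
  ultimately show ?case by auto
qed

text \<open>Let \<open>m\<close> be the least moved point. Everything below \<open>m\<close> is
  fixed, so injectivity puts \<open>f m\<close> above \<open>m\<close>, and the preimage
  \<open>z\<close> of \<open>m\<close> also lies above \<open>m\<close>. Monotonicity then gives
  \<open>f m < f z = m\<close>, a contradiction.\<close>

lemma strict_mono_bij_same:
  fixes f :: "'a::linorder \<Rightarrow> 'a"
  assumes "finite A" and f: "bij_betw f A A" "strict_mono_on A f" and "x \<in> A"
  shows "f x = x"
proof (rule ccontr)
  assume "f x \<noteq> x"
  define N where "N = {x \<in> A. f x \<noteq> x}"
  have N: "finite N" "N \<noteq> {}" using assms \<open>f x \<noteq> x\<close> by (auto simp: N_def)
  define m where "m = Min N"
  have m: "m \<in> A" "f m \<noteq> m" using Min_in[OF N] by (auto simp: N_def m_def)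
  have lt: "f y = y" if "y \<in> A" "y < m" for y
    using that Min_le[OF N(1), of y] by (metis (mono_tags, lifting) N_def leD m_def mem_Collect_eq)
  have inj: "inj_on f A" using f by (simp add: bij_betw_def)
  have fm: "f m \<in> A" using f m by (auto dest: bij_betwE)
  have "f m > m"
    using lt[OF fm] inj_onD[OF inj _ fm m(1)] m(2) by (meson linorder_neqE)
  obtain z where z: "z \<in> A" "f z = m" using f m by (metis bij_betw_imp_surj_on imageE)
  have "z > m" using lt z m by (metis linorder_neqE)
  then have "f m < f z" using strict_mono_onD[OF f(2)] m z by blast
  then show False using z \<open>f m > m\<close> by simp
qed

section \<open>Metric spaces, ultrametrics and spectra\<close>

lemma mdist_commute: "mdist X x y = mdist X y x"
  by (rule Metric_space.commute[OF Metric_space_mspace_mdist])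

lemma mdist_nonneg [simp]: "mdist X x y \<ge> 0"
  by (rule Metric_space.nonneg[OF Metric_space_mspace_mdist])

lemma mdist_eq_0_iff: "x \<in> mspace X \<Longrightarrow> y \<in> mspace X \<Longrightarrow> mdist X x y = 0 \<longleftrightarrow> x = y"
  by (rule Metric_space.zero[OF Metric_space_mspace_mdist])

lemma mdist_self [simp]: "x \<in> mspace X \<Longrightarrow> mdist X x x = 0"
  by (simp add: mdist_eq_0_iff)

text \<open>The strong triangle inequality yields the ordinary one because the maximum of two
  nonnegative numbers is at most their sum.\<close>

lemma obtain_ultrametric:
  assumes "\<And>x y. x \<in> M \<Longrightarrow> y \<in> M \<Longrightarrow> d x y \<ge> 0"
    and "\<And>x y. x \<in> M \<Longrightarrow> y \<in> M \<Longrightarrow> d x y = d y x"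
    and "\<And>x y. x \<in> M \<Longrightarrow> y \<in> M \<Longrightarrow> d x y = 0 \<longleftrightarrow> x = y"
    and ultra: "\<And>x y z. x \<in> M \<Longrightarrow> y \<in> M \<Longrightarrow> z \<in> M \<Longrightarrow> d x y \<le> max (d x z) (d z y)"
  obtains X where "mspace X = M" "\<And>x y. x \<in> M \<Longrightarrow> y \<in> M \<Longrightarrow> mdist X x y = d x y" "ultrametric X"
proof -
  \<comment> \<open>The locale \<open>Metric_space\<close> requires nonnegativity and symmetry for
    all arguments, not only for points of \<open>M\<close>; the default value 0 outside
    \<open>M\<close> secures both.\<close>
  define e where "e x y = (if x \<in> M \<and> y \<in> M then d x y else 0)" for x y
  interpret Metric_space M e
  proof
    fix x y z assume "x \<in> M" "y \<in> M" "z \<in> M"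
    then show "e x z \<le> e x y + e y z"
      using ultra[of x z y] assms(1)[of x y] assms(1)[of y z] by (simp add: e_def)
  qed (use assms in \<open>auto simp: e_def\<close>)
  show thesis
    by (rule that[of "metric (M, e)"]) (use ultra in \<open>auto simp: e_def ultrametric_def\<close>)
qed

lemma spectrum_nonneg: "spectrum X \<subseteq> {0..}"
  by (auto simp: spectrum_def)

lemma finite_spectrum: "finite (mspace X) \<Longrightarrow> finite (spectrum X)"
  unfolding spectrum_def by (rule finite_image_set2) auto

lemma zero_in_spectrum_iff: "0 \<in> spectrum X \<longleftrightarrow> mspace X \<noteq> {}"
proof
  show "0 \<in> spectrum X" if "mspace X \<noteq> {}"
    using that mdist_in_spectrum mdist_eq_0_iff by (metis ex_in_conv)
qed (auto simp: spectrum_def)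

lemma spectrum_empty_iff: "spectrum X = {} \<longleftrightarrow> mspace X = {}"
  by (auto simp: spectrum_def)

lemma isometric_spectrum_subset: "isometric X Y \<Longrightarrow> spectrum X \<subseteq> spectrum Y"
  unfolding isometric_def spectrum_def using bij_betw_apply by fastforce

lemma isometric_spectrum: "isometric X Y \<Longrightarrow> spectrum X = spectrum Y"
  by (intro subset_antisym isometric_spectrum_subset) (auto intro: isometric_sym)

section \<open>Isometry classes of spaces with prescribed spectrum\<close>

text \<open>The number of points is not recorded, since for members of \<UU> it equals
  \<open>card S\<close>.\<close>

definition spaces :: "real set \<Rightarrow> 'a metric set" where
  "spaces S = {X \<in> \<UU>. spectrum X = S}"

definition classes :: "real set \<Rightarrow> 'a metric set set" where
  "classes S = spaces S // isometry_rel (spaces S)"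

lemma classes_member: "Y \<in> y \<Longrightarrow> y \<in> classes S \<Longrightarrow> Y \<in> spaces S"
  by (auto simp: classes_def quotient_def isometry_rel_def)

lemma classes_eq_iff:
  assumes "y \<in> classes S" "y' \<in> classes S" "Y \<in> y" "Y' \<in> y'"
  shows "y = y' \<longleftrightarrow> isometric Y Y'"
proof -
  have "y = y' \<longleftrightarrow> (Y, Y') \<in> isometry_rel (spaces S)"
    using assms unfolding classes_def by (intro quotient_eq_iff[OF equiv_isometry_rel])
  then show ?thesis
    using assms classes_member by (auto simp: isometry_rel_def)
qed

lemma classes_ex_member: "y \<in> classes S \<Longrightarrow> \<exists>Y\<in>y. Y \<in> spaces S"
  using equiv_class_self[OF equiv_isometry_rel] unfolding classes_def
  by (elim quotientE) auto

lemma ex_class: "Y \<in> spaces S \<Longrightarrow> \<exists>y\<in>classes S. Y \<in> y"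
  unfolding classes_def
  by (rule bexI[of _ "isometry_rel (spaces S) `` {Y}"], rule equiv_class_self[OF equiv_isometry_rel])
    (auto intro: quotientI)

lemma classes_isometric:
  assumes "y \<in> classes S" "Y \<in> y" "isometric Y Z" "Z \<in> spaces S"
  shows "Z \<in> y"
proof -
  obtain z where z: "z \<in> classes S" "Z \<in> z" using ex_class[OF assms(4)] by blast
  then have "y = z" using classes_eq_iff[OF assms(1) z(1) assms(2) z(2)] assms(3) by simp
  then show ?thesis using z(2) by simp
qed

section \<open>Weak similarity versus isometry\<close>

text \<open>The rescaling function is an increasing bijection of one finite set onto itself, hence
  the identity.\<close>

lemma weakly_similar_imp_isometric:
  assumes "weakly_similar X Y" "spectrum X = spectrum Y" "finite (spectrum X)"
  shows "isometric X Y"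
proof -
  obtain \<Phi> f where *: "bij_betw \<Phi> (mspace X) (mspace Y)"
      "bij_betw f (spectrum Y) (spectrum Y)" "strict_mono_on (spectrum Y) f"
      "\<forall>x\<in>mspace X. \<forall>y\<in>mspace X. mdist X x y = f (mdist Y (\<Phi> x) (\<Phi> y))"
    using assms unfolding weakly_similar_def by auto
  have "f (mdist Y (\<Phi> x) (\<Phi> y)) = mdist Y (\<Phi> x) (\<Phi> y)"
    if "x \<in> mspace X" "y \<in> mspace X" for x y
    using strict_mono_bij_same[OF _ *(2,3)] mdist_in_spectrum bij_betw_apply[OF *(1)] that assms
    by metis
  then show ?thesis unfolding isometric_def using * by auto
qed

lemma isometric_imp_weakly_similar:
  assumes "isometric X Y"
  shows "weakly_similar X Y"
proof -
  obtain \<Phi> where \<Phi>: "bij_betw \<Phi> (mspace X) (mspace Y)"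
    "\<forall>x\<in>mspace X. \<forall>y\<in>mspace X. mdist X x y = mdist Y (\<Phi> x) (\<Phi> y)"
    using assms unfolding isometric_def by blast
  show ?thesis
    unfolding weakly_similar_def isometric_spectrum[OF assms]
    by (intro exI[of _ \<Phi>] exI[of _ id]) (use \<Phi> in \<open>simp add: strict_mono_on_id\<close>)
qed

text \<open>The points stay and the distances are pushed through the increasing bijection
  \<open>f\<close> from the spectrum onto \<open>T\<close>. A monotone map preserves the strong
  triangle inequality, and definiteness survives because \<open>f\<close> is injective and fixes
  0.\<close>

lemma ex_relabel:
  fixes X :: "'a metric"
  assumes X: "X \<in> \<UU>_card n" and T: "T \<subseteq> {0..}" "0 \<in> T" "card T = n" and n: "n > 0"
  shows "\<exists>X'\<in>(spaces T :: 'a metric set). weakly_similar X X'"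
proof -
  have fin: "finite (mspace X)" "ultrametric X" and c: "card (spectrum X) = n" "card (mspace X) = n"
    using X by (auto simp: \<UU>_card_def \<UU>_def)
  have ne: "mspace X \<noteq> {}" using c n by auto
  have finT: "finite T" using T n card_ge_0_finite by auto
  obtain f where f: "bij_betw f (spectrum X) T" "strict_mono_on (spectrum X) f"
    using ex_strict_mono_bij[OF finite_spectrum[OF fin(1)] finT] c T by auto
  have fT: "f a \<in> T" if "a \<in> spectrum X" for a using f that by (auto dest: bij_betwE)
  have mono: "f a \<le> f b" if "a \<in> spectrum X" "b \<in> spectrum X" "a \<le> b" for a b
    using strict_mono_onD[OF f(2)] that by (metis less_eq_real_def order_refl)
  have inj: "f a = f b \<longleftrightarrow> a = b" if "a \<in> spectrum X" "b \<in> spectrum X" for a b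
    using f(1) that by (auto simp: bij_betw_def inj_on_def)
  have 0: "0 \<in> spectrum X" using ne by (simp add: zero_in_spectrum_iff)
  obtain a where a: "a \<in> spectrum X" "f a = 0" using f(1) T by (metis bij_betw_imp_surj_on imageE)
  \<comment> \<open>0 is the least distance, so \<open>f 0\<close> is at most
    \<open>f a = 0\<close>, while \<open>T\<close> has no negative elements.\<close>
  have f0: "f 0 = 0"
    using mono[OF 0 a(1)] a T(1) spectrum_nonneg[of X] fT[OF 0] by fastforce
  note sp = mdist_in_spectrum[of _ X]
  obtain X' where X': "mspace X' = mspace X" "ultrametric X'"
    "\<And>x y. x \<in> mspace X \<Longrightarrow> y \<in> mspace X \<Longrightarrow> mdist X' x y = f (mdist X x y)"
  proof (rule obtain_ultrametric[of "mspace X" "\<lambda>x y. f (mdist X x y)"])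
    fix x y z assume *: "x \<in> mspace X" "y \<in> mspace X" "z \<in> mspace X"
    have "mdist X x y \<le> max (mdist X x z) (mdist X z y)"
      using fin * by (auto simp: ultrametric_def)
    then show "f (mdist X x y) \<le> max (f (mdist X x z)) (f (mdist X z y))"
      using mono sp * by (metis le_max_iff_disj)
  next
    fix x y assume *: "x \<in> mspace X" "y \<in> mspace X"
    show "f (mdist X x y) \<ge> 0" using subsetD[OF T(1) fT[OF sp[OF *]]] by simp
    show "f (mdist X x y) = f (mdist X y x)" by (simp add: mdist_commute)
    show "f (mdist X x y) = 0 \<longleftrightarrow> x = y"
      using inj[OF sp[OF *] 0] f0 mdist_eq_0_iff[OF *] by simp
  qed blast
  have "spectrum Y = (\<lambda>(x, y). mdist Y x y) ` (mspace Y \<times> mspace Y)" for Y :: "'a metric"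
    by (auto simp: spectrum_def)
  then have "spectrum X' = f ` spectrum X"
    using X'(1,3) by (auto simp: image_image case_prod_beta intro!: image_cong)
  then have sX': "spectrum X' = T" using f by (simp add: bij_betw_def)
  have "X' \<in> spaces T"
    using X' fin c T sX' by (auto simp: spaces_def \<UU>_def)
  moreover have "weakly_similar X' X"
    unfolding weakly_similar_def
    by (rule exI[of _ id], rule exI[of _ f]) (use X' sX' f in auto)
  ultimately show ?thesis using weakly_similar_sym[of X' X] by blast
qed

lemma spaces_UU_card: "card T = n \<Longrightarrow> spaces T = {X \<in> \<UU>_card n. spectrum X = T}"
  by (auto simp: spaces_def \<UU>_card_def \<UU>_def)

text \<open>Every weak similarity class contains spaces with spectrum \<open>T\<close>, by
  relabelling, and these form a single isometry class, because both relations agree once the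
  spectrum is fixed. So the number of isometry classes depends on \<open>T\<close> only through its
  size.\<close>

lemma card_classes_eq_kappa:
  assumes T: "T \<subseteq> {0..}" "0 \<in> T" "card T = n" and n: "n > 0"
  shows "card (classes T :: 'a::infinite metric set set) = kappa TYPE('a) n"
  unfolding kappa_def
proof (rule sym, rule card_quotient_eqI[OF equiv_weak_similarity_rel,
      where R = "\<lambda>X c. \<exists>X'\<in>c. weakly_similar X X'"])
  fix X :: "'a metric" assume "X \<in> \<UU>_card n"
  then show "\<exists>c\<in>(classes T :: 'a metric set set). \<exists>X'\<in>c. weakly_similar X X'"
    using ex_relabel[OF _ assms, of X] ex_class by blast
next
  fix c :: "'a metric set" assume "c \<in> classes T"
  then show "\<exists>X\<in>(\<UU>_card n :: 'a metric set). \<exists>X'\<in>c. weakly_similar X X'"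
    using classes_ex_member[of c T] weakly_similar_refl unfolding spaces_UU_card[OF T(3)] by fast
next
  fix X Y :: "'a metric" and c c' :: "'a metric set"
  assume *: "X \<in> \<UU>_card n" "Y \<in> \<UU>_card n" "c \<in> classes T" "c' \<in> classes T"
    "\<exists>X'\<in>c. weakly_similar X X'" "\<exists>X'\<in>c'. weakly_similar Y X'"
  then obtain X' Y' where **: "X' \<in> c" "weakly_similar X X'" "Y' \<in> c'" "weakly_similar Y Y'"
    by blast
  have fT: "finite T" using assms card_ge_0_finite by auto
  have sp: "spectrum X' = T" "spectrum Y' = T"
    using classes_member * ** by (auto simp: spaces_def dest: classes_member)
  have "c = c' \<longleftrightarrow> isometric X' Y'" using classes_eq_iff * ** by blast
  also have "\<dots> \<longleftrightarrow> weakly_similar X' Y'"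
    using sp fT weakly_similar_imp_isometric[of X' Y'] isometric_imp_weakly_similar[of X' Y'] by auto
  also have "\<dots> \<longleftrightarrow> weakly_similar X Y"
    using **(2,4) weakly_similar_sym[of X X'] weakly_similar_sym[of Y Y']
      weakly_similar_trans[of X X' Y'] weakly_similar_trans[of X Y' Y]
      weakly_similar_trans[of X' X Y] weakly_similar_trans[of X' Y Y'] by blast
  finally show "(X, Y) \<in> weak_similarity_rel (\<UU>_card n) \<longleftrightarrow> c = c'"
    using * by (simp add: weak_similarity_rel_def)
qed

section \<open>Finiteness of the set of isometry classes\<close>

text \<open>Numbering the points turns a space into a matrix with entries in \<open>S\<close>. Such
  a matrix determines the isometry class, and there are only finitely many of them.\<close>

lemma finite_classes:
  assumes "finite S"
  shows "finite (classes S :: 'a metric set set)"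
proof -
  define I where "I = {..<card S}"
  \<comment> \<open>\<open>g\<close> is the distance matrix of \<open>X\<close> for some numbering
    of its points; a space may have several such matrices, which is why this is a relation.\<close>
  define code where "code X g \<longleftrightarrow>
    (\<exists>h. bij_betw h I (mspace X) \<and> (\<forall>i\<in>I. \<forall>j\<in>I. mdist X (h i) (h j) = g (i, j)))"
    for X :: "'a metric" and g
  have code_iso: "code Y g" if cX: "code X g" and iso: "isometric X Y" for X Y :: "'a metric" and g
  proof -
    obtain h where h: "bij_betw h I (mspace X)" "\<forall>i\<in>I. \<forall>j\<in>I. mdist X (h i) (h j) = g (i, j)"
      using cX unfolding code_def by blast
    obtain \<Phi> where "bij_betw \<Phi> (mspace X) (mspace Y)"
      "\<forall>x\<in>mspace X. \<forall>y\<in>mspace X. mdist X x y = mdist Y (\<Phi> x) (\<Phi> y)"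
      using iso unfolding isometric_def by blast
    then show "code Y g"
      unfolding code_def using h bij_betw_apply[OF h(1)]
      by (intro exI[of _ "\<Phi> \<circ> h"]) (auto intro: bij_betw_trans)
  qed
  have iso_code: "isometric X Y" if cX: "code X g" and cY: "code Y g" for X Y :: "'a metric" and g
  proof -
    obtain h where h: "bij_betw h I (mspace X)" "\<forall>i\<in>I. \<forall>j\<in>I. mdist X (h i) (h j) = g (i, j)"
      using cX unfolding code_def by blast
    obtain k where k: "bij_betw k I (mspace Y)" "\<forall>i\<in>I. \<forall>j\<in>I. mdist Y (k i) (k j) = g (i, j)"
      using cY unfolding code_def by blast
    have b: "bij_betw (the_inv_into I h) (mspace X) I" using h(1) by (rule bij_betw_the_inv_into)
    have "mdist X x y = mdist Y (k (the_inv_into I h x)) (k (the_inv_into I h y))"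
      if "x \<in> mspace X" "y \<in> mspace X" for x y
      using h(2)[rule_format, of "the_inv_into I h x" "the_inv_into I h y"]
        k(2)[rule_format, of "the_inv_into I h x" "the_inv_into I h y"] bij_betw_apply[OF b] that
      by (simp add: f_the_inv_into_f_bij_betw[OF h(1)])
    then show ?thesis
      unfolding isometric_def using bij_betw_trans[OF b k(1)] by (intro exI[of _ "k \<circ> the_inv_into I h"]) simp
  qed
  have ex: "\<exists>g \<in> I \<times> I \<rightarrow>\<^sub>E S. code X g" if "X \<in> spaces S" for X
  proof -
    have X: "finite (mspace X)" "card (mspace X) = card S" "spectrum X = S"
      using that by (auto simp: spaces_def \<UU>_def)
    obtain h where h: "bij_betw h I (mspace X)"
      using finite_same_card_bij[of I "mspace X"] X by (auto simp: I_def)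
    show ?thesis
    proof (rule bexI)
      show "code X (\<lambda>p\<in>I \<times> I. mdist X (h (fst p)) (h (snd p)))"
        unfolding code_def using h by auto
      show "(\<lambda>p\<in>I \<times> I. mdist X (h (fst p)) (h (snd p))) \<in> I \<times> I \<rightarrow>\<^sub>E S"
        using bij_betw_apply[OF h] mdist_in_spectrum[of _ X] X(3) by auto
    qed
  qed
  \<comment> \<open>Only an inclusion is claimed: a matrix that belongs to no space yields the empty
    set, which is not a class.\<close>
  have "classes S \<subseteq> (\<lambda>g. {X \<in> spaces S. code X g}) ` (I \<times> I \<rightarrow>\<^sub>E S)"
  proof
    fix c :: "'a metric set" assume c: "c \<in> classes S"
    obtain X where X: "X \<in> c" "X \<in> spaces S" using classes_ex_member[OF c] by blast
    obtain g where g: "g \<in> I \<times> I \<rightarrow>\<^sub>E S" "code X g" using ex[OF X(2)] by blast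
    have "c = {X \<in> spaces S. code X g}"
    proof (intro subset_antisym subsetI CollectI conjI)
      fix Y assume Y: "Y \<in> c"
      then show "Y \<in> spaces S" using c by (rule classes_member)
      have "isometric X Y" using classes_eq_iff[OF c c X(1) Y] by simp
      then show "code Y g" using code_iso g(2) by blast
    next
      fix Y assume "Y \<in> {X \<in> spaces S. code X g}"
      then show "Y \<in> c" using classes_isometric[OF c X(1)] iso_code[OF g(2)] by blast
    qed
    then show "c \<in> (\<lambda>g. {X \<in> spaces S. code X g}) ` (I \<times> I \<rightarrow>\<^sub>E S)" using g(1) by blast
  qed
  moreover have "finite (I \<times> I \<rightarrow>\<^sub>E S)"
    using assms by (intro finite_PiE) (auto simp: I_def)
  ultimately show ?thesis using finite_surj by blast
qed

section \<open>Joins of two spaces at constant distance\<close>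

text \<open>A relation rather than an operation: both parts live in the same type and must have
  disjoint point sets, so two given spaces can be joined only after one of them has been moved if
  they overlap. Distances from \<open>Z\<close> to \<open>Y\<close> follow by symmetry.\<close>

definition join :: "real \<Rightarrow> 'a metric \<Rightarrow> 'a metric \<Rightarrow> 'a metric \<Rightarrow> bool" where
  "join D X Y Z \<longleftrightarrow> mspace X = mspace Y \<union> mspace Z \<and> mspace Y \<inter> mspace Z = {} \<and>
     (\<forall>x\<in>mspace Y. \<forall>y\<in>mspace Y. mdist X x y = mdist Y x y) \<and>
     (\<forall>x\<in>mspace Z. \<forall>y\<in>mspace Z. mdist X x y = mdist Z x y) \<and>
     (\<forall>y\<in>mspace Y. \<forall>z\<in>mspace Z. mdist X y z = D)"

lemma join_commute: "join D X Y Z \<Longrightarrow> join D X Z Y"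
  unfolding join_def by (auto intro: trans[OF mdist_commute])

lemma join_spectrum:
  assumes "join D X Y Z" "mspace Y \<noteq> {}" "mspace Z \<noteq> {}"
  shows "spectrum X = insert D (spectrum Y \<union> spectrum Z)"
proof -
  have "mdist X x y \<in> insert D (spectrum Y \<union> spectrum Z)" if "x \<in> mspace X" "y \<in> mspace X" for x y
    using that assms(1) mdist_commute[of X x y] by (auto simp: join_def mdist_in_spectrum)
  then have "spectrum X \<subseteq> insert D (spectrum Y \<union> spectrum Z)"
    by (auto simp: spectrum_def)
  moreover have "spectrum Y \<subseteq> spectrum X" "spectrum Z \<subseteq> spectrum X"
    using assms(1) mdist_in_spectrum[of _ X]
    by (auto simp: spectrum_def[of Y] spectrum_def[of Z] join_def) (metis UnI1 UnI2)+
  moreover have "D \<in> spectrum X"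
  proof -
    obtain y z where "y \<in> mspace Y" "z \<in> mspace Z" using assms by blast
    then show ?thesis
      using assms(1) mdist_in_spectrum[of y X z] by (simp add: join_def)
  qed
  ultimately show ?thesis by blast
qed

lemma join_card:
  assumes "join D X Y Z" "finite (mspace X)"
  shows "card (mspace X) = card (mspace Y) + card (mspace Z)"
  using assms by (auto simp: join_def intro: card_Un_disjoint)

lemma ultrametric_submetric: "ultrametric X \<Longrightarrow> ultrametric (submetric X A)"
  by (simp add: ultrametric_def)

text \<open>The points at distance less than the diameter from a given point form an open ball, and by
  the isosceles property every point outside it is at distance exactly the diameter from every point
  inside.\<close>

lemma ultrametric_split:
  assumes fin: "finite (mspace X)" and u: "ultrametric X" and c: "card (mspace X) \<ge> 2"
  obtains Y Z where "join (Max (spectrum X)) X Y Z" "mspace Y \<noteq> {}" "mspace Z \<noteq> {}"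
    "ultrametric Y" "ultrametric Z"
proof -
  define D where "D = Max (spectrum X)"
  have ne: "mspace X \<noteq> {}" using c by auto
  have D_in: "D \<in> spectrum X"
    unfolding D_def using Max_in finite_spectrum[OF fin] spectrum_empty_iff ne by blast
  have D_ge: "mdist X x y \<le> D" if "x \<in> mspace X" "y \<in> mspace X" for x y
    unfolding D_def using finite_spectrum[OF fin] mdist_in_spectrum that by (metis Max_ge)
  obtain p q where pq: "p \<in> mspace X" "q \<in> mspace X" "mdist X p q = D"
    using D_in by (auto simp: spectrum_def)
  obtain a b where ab: "a \<in> mspace X" "b \<in> mspace X" "a \<noteq> b"
    using c card_le_Suc0_iff_eq[OF fin] by auto
  \<comment> \<open>Positivity places \<open>p\<close> in its own ball \<open>Y\<close>; the point
    \<open>q\<close> will show that the complement \<open>Z\<close> is nonempty.\<close>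
  have D_pos: "D > 0"
    using D_ge[OF ab(1,2)] mdist_eq_0_iff[OF ab(1,2)] ab(3) mdist_nonneg[of X a b] by linarith
  define Y where "Y = submetric X {y \<in> mspace X. mdist X p y < D}"
  define Z where "Z = submetric X {y \<in> mspace X. \<not> mdist X p y < D}"
  have cross: "mdist X y z = D" if "y \<in> mspace Y" "z \<in> mspace Z" for y z
  proof -
    have "mdist X p z \<le> max (mdist X p y) (mdist X y z)"
      using u pq that by (auto simp: Y_def Z_def ultrametric_def)
    then show ?thesis using that D_ge[of y z] by (auto simp: Y_def Z_def)
  qed
  have "join D X Y Z"
    unfolding join_def using cross by (auto simp: Y_def Z_def)
  moreover have "p \<in> mspace Y" using pq(1) D_pos by (simp add: Y_def)
  moreover have "q \<in> mspace Z" using pq by (simp add: Z_def)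
  moreover have "ultrametric Y" "ultrametric Z"
    unfolding Y_def Z_def by (rule ultrametric_submetric[OF u])+
  ultimately show thesis using that unfolding D_def by blast
qed

section \<open>Number of distances versus number of points\<close>

text \<open>Induction along the splitting: the join adds at most one new distance, and this is
  offset by 0 lying in the spectra of both parts.\<close>

lemma card_spectrum_le:
  assumes "finite (mspace X)" "ultrametric X" "mspace X \<noteq> {}"
  shows "card (spectrum X) \<le> card (mspace X)"
  using assms
proof (induction "card (mspace X)" arbitrary: X rule: less_induct)
  case less
  show ?case
  proof (cases "card (mspace X) \<ge> 2")
    case False
    then have "card (mspace X) = 1"
      using less.prems by (metis One_nat_def Suc_leI card_gt_0_iff le_antisym not_less_eq_eq numeral_2_eq_2)
    then obtain x where "mspace X = {x}" using card_1_singletonE by blast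
    then have "spectrum X = {0}"
      by (auto simp: spectrum_def)
    then show ?thesis using \<open>card (mspace X) = 1\<close> by simp
  next
    case True
    obtain D Y Z where j: "join D X Y Z" and ne: "mspace Y \<noteq> {}" "mspace Z \<noteq> {}"
      and u: "ultrametric Y" "ultrametric Z"
      by (rule ultrametric_split[OF less.prems(1,2) True])
    have fin: "finite (mspace Y)" "finite (mspace Z)"
      using j less.prems by (auto simp: join_def)
    have c: "card (mspace X) = card (mspace Y) + card (mspace Z)"
      using join_card[OF j less.prems(1)] .
    have pos: "card (mspace Y) > 0" "card (mspace Z) > 0" using ne fin by (auto simp: card_gt_0_iff)
    have IH: "card (spectrum Y) \<le> card (mspace Y)" "card (spectrum Z) \<le> card (mspace Z)"
      using less.hyps[of Y] less.hyps[of Z] c pos fin u ne by auto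
    have f: "finite (spectrum Y)" "finite (spectrum Z)" using fin by (auto intro: finite_spectrum)
    have "0 \<in> spectrum Y \<inter> spectrum Z" using ne by (simp add: zero_in_spectrum_iff)
    then have "card (spectrum Y \<inter> spectrum Z) \<ge> 1"
      using card_mono[of "spectrum Y \<inter> spectrum Z" "{0}"] f by simp
    moreover have "card (spectrum X) \<le> Suc (card (spectrum Y \<union> spectrum Z))"
      using join_spectrum[OF j ne] f by (simp add: card_insert_if)
    ultimately show ?thesis using card_Un_Int[OF f] IH c by linarith
  qed
qed

text \<open>Equality in the bound on the cardinality of the spectrum forces equality for both parts, and
  no distance can be lost when the spectra are united.\<close>

lemma UU_split:
  assumes X: "X \<in> \<UU>" and c2: "card (mspace X) \<ge> 2"
  obtains Y Z where "join (Max (spectrum X)) X Y Z" "Y \<in> \<UU>" "Z \<in> \<UU>"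
    "mspace Y \<noteq> {}" "mspace Z \<noteq> {}" "spectrum Y \<inter> spectrum Z = {0}"
    "Max (spectrum X) \<notin> spectrum Y \<union> spectrum Z"
proof -
  have X': "finite (mspace X)" "ultrametric X" "card (spectrum X) = card (mspace X)"
    using X by (auto simp: \<UU>_def)
  define D where "D = Max (spectrum X)"
  obtain Y Z where j: "join D X Y Z" and ne: "mspace Y \<noteq> {}" "mspace Z \<noteq> {}"
    and u: "ultrametric Y" "ultrametric Z"
    unfolding D_def by (rule ultrametric_split[OF X'(1,2) c2])
  have fin: "finite (mspace Y)" "finite (mspace Z)"
    using j X' by (auto simp: join_def)
  have c: "card (mspace X) = card (mspace Y) + card (mspace Z)"
    using join_card[OF j X'(1)] .
  have le: "card (spectrum Y) \<le> card (mspace Y)" "card (spectrum Z) \<le> card (mspace Z)"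
    using card_spectrum_le fin u ne by auto
  have f: "finite (spectrum Y)" "finite (spectrum Z)" using fin by (auto intro: finite_spectrum)
  have 0: "{0} \<subseteq> spectrum Y \<inter> spectrum Z" using ne by (simp add: zero_in_spectrum_iff)
  have i: "card (spectrum Y \<inter> spectrum Z) \<ge> 1"
    using card_mono[OF _ 0] f by simp
  have s: "card (spectrum X) = (if D \<in> spectrum Y \<union> spectrum Z
      then card (spectrum Y \<union> spectrum Z) else Suc (card (spectrum Y \<union> spectrum Z)))"
    using join_spectrum[OF j ne] f by (simp add: card_insert_if)
  have eq: "card (spectrum Y) = card (mspace Y)" "card (spectrum Z) = card (mspace Z)"
    and one: "card (spectrum Y \<inter> spectrum Z) = 1"
    and D: "D \<notin> spectrum Y \<union> spectrum Z"
    using card_Un_Int[OF f] le c i s X'(3) by (auto split: if_splits)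
  have "spectrum Y \<inter> spectrum Z = {0}"
    using card_subset_eq[OF _ 0] one f by simp
  then show thesis
    using that[of Y Z] j ne u fin eq D unfolding D_def by (auto simp: \<UU>_def)
qed

section \<open>Construction of joins\<close>

text \<open>Infinity of the type supplies enough points outside \<open>A\<close>; the metric is
  transported along an injection into them.\<close>

lemma ex_disjoint_copy:
  fixes Z :: "'a::infinite metric"
  assumes "finite (mspace Z)" "ultrametric Z" "finite A"
  obtains Z' :: "'a metric" where "isometric Z Z'" "mspace Z' \<inter> A = {}" "ultrametric Z'"
proof -
  obtain h :: "'a \<Rightarrow> 'a" where h: "inj_on h (mspace Z)" "h ` mspace Z \<inter> A = {}"
  proof -
    obtain B :: "'a set" where "A \<inter> B = {}" "finite B" "card (mspace Z) \<le> card B"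
      using arb_finite_subset[OF assms(3)] by blast
    then show thesis
      using card_le_inj[OF assms(1), of B] that by blast
  qed
  define g where "g = the_inv_into (mspace Z) h"
  have g: "g (h x) = x" if "x \<in> mspace Z" for x
    using that h by (simp add: g_def the_inv_into_f_f)
  obtain Z' where Z': "mspace Z' = h ` mspace Z" "ultrametric Z'"
    "\<And>x y. x \<in> h ` mspace Z \<Longrightarrow> y \<in> h ` mspace Z \<Longrightarrow> mdist Z' x y = mdist Z (g x) (g y)"
  proof (rule obtain_ultrametric[of "h ` mspace Z" "\<lambda>x y. mdist Z (g x) (g y)"])
    show "mdist Z (g x) (g y) = mdist Z (g y) (g x)" for x y by (rule mdist_commute)
  qed (use assms(2) g mdist_eq_0_iff in \<open>auto simp: ultrametric_def\<close>)
  have "isometric Z Z'"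
    unfolding isometric_def
    by (rule exI[of _ h]) (use h Z' g in \<open>auto simp: bij_betw_def\<close>)
  then show thesis using that Z' h by auto
qed

lemma isometric_UU:
  assumes "isometric X Y" "X \<in> \<UU>"
  shows "Y \<in> \<UU>"
proof -
  obtain \<Phi> where b: "bij_betw \<Phi> (mspace Y) (mspace X)"
    and d: "\<And>x y. x\<in>mspace Y \<Longrightarrow> y\<in>mspace Y \<Longrightarrow> mdist Y x y = mdist X (\<Phi> x) (\<Phi> y)"
    using isometric_sym[OF assms(1)] unfolding isometric_def by blast
  have "ultrametric Y"
    unfolding ultrametric_def using assms(2) d bij_betw_apply[OF b] by (simp add: \<UU>_def ultrametric_def)
  then show ?thesis
    using assms(2) bij_betw_same_card[OF b] bij_betw_finite[OF b] isometric_spectrum[OF assms(1)]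
    by (simp add: \<UU>_def)
qed

lemma isometric_spaces: "isometric X Y \<Longrightarrow> X \<in> spaces S \<Longrightarrow> Y \<in> spaces S"
  using isometric_UU isometric_spectrum unfolding spaces_def by blast

text \<open>Converse of the splitting: \<open>Y\<close> is kept and \<open>Z\<close> is replaced by
  a copy disjoint from it. Since \<open>D\<close> exceeds all distances inside the parts, triangles
  meeting both parts are isosceles with two long sides \<open>D\<close>.\<close>

lemma ex_join:
  fixes Y Z :: "'a::infinite metric"
  assumes Y: "Y \<in> \<UU>" "mspace Y \<noteq> {}" and Z: "Z \<in> \<UU>" "mspace Z \<noteq> {}"
    and i: "spectrum Y \<inter> spectrum Z = {0}" and D: "\<And>r. r \<in> spectrum Y \<union> spectrum Z \<Longrightarrow> r < D"
  obtains X Z' where "isometric Z Z'" "join D X Y Z'" "X \<in> \<UU>"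
    "spectrum X = insert D (spectrum Y \<union> spectrum Z)"
proof -
  have Y': "finite (mspace Y)" "ultrametric Y" "card (spectrum Y) = card (mspace Y)"
    using Y by (auto simp: \<UU>_def)
  obtain Z' where Z': "isometric Z Z'" "mspace Z' \<inter> mspace Y = {}" "ultrametric Z'"
    using ex_disjoint_copy[of Z "mspace Y"] Z Y' by (auto simp: \<UU>_def)
  have "Z' \<in> \<UU>" using isometric_UU Z' Z by blast
  then have fZ': "finite (mspace Z')" "card (spectrum Z') = card (mspace Z')" by (auto simp: \<UU>_def)
  have sZ': "spectrum Z' = spectrum Z" using Z' isometric_spectrum by metis
  have nZ': "mspace Z' \<noteq> {}" using Z sZ' by (metis spectrum_empty_iff)
  have D0: "D > 0" using D i by blast
  have dY: "mdist Y x y < D" if "x \<in> mspace Y" "y \<in> mspace Y" for x y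
    using D mdist_in_spectrum[OF that] by blast
  have dZ: "mdist Z' x y < D" if "x \<in> mspace Z'" "y \<in> mspace Z'" for x y
    using D mdist_in_spectrum[OF that] sZ' by blast
  define d where "d x y = (if x \<in> mspace Y \<and> y \<in> mspace Y then mdist Y x y
    else if x \<in> mspace Z' \<and> y \<in> mspace Z' then mdist Z' x y else D)" for x y
  obtain X where X: "mspace X = mspace Y \<union> mspace Z'" "ultrametric X"
    "\<And>x y. x \<in> mspace X \<Longrightarrow> y \<in> mspace X \<Longrightarrow> mdist X x y = d x y"
  proof (rule obtain_ultrametric[of "mspace Y \<union> mspace Z'" d])
    fix x y assume *: "x \<in> mspace Y \<union> mspace Z'" "y \<in> mspace Y \<union> mspace Z'"
    show "d x y \<ge> 0" using D0 by (simp add: d_def)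
    show "d x y = d y x" by (auto simp: d_def mdist_commute)
    show "d x y = 0 \<longleftrightarrow> x = y"
      using * D0 Z'(2) mdist_eq_0_iff[of x Y y] mdist_eq_0_iff[of x Z' y] by (auto simp: d_def)
    fix z assume z: "z \<in> mspace Y \<union> mspace Z'"
    have disj: "\<not> (w \<in> mspace Y \<and> w \<in> mspace Z')" for w using Z'(2) by blast
    have uY: "\<lbrakk>x \<in> mspace Y; y \<in> mspace Y; z \<in> mspace Y\<rbrakk> \<Longrightarrow> mdist Y x y \<le> max (mdist Y x z) (mdist Y z y)"
      using Y'(2) by (simp add: ultrametric_def)
    have uZ: "\<lbrakk>x \<in> mspace Z'; y \<in> mspace Z'; z \<in> mspace Z'\<rbrakk> \<Longrightarrow> mdist Z' x y \<le> max (mdist Z' x z) (mdist Z' z y)"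
      using Z'(3) by (simp add: ultrametric_def)
    \<comment> \<open>If \<open>x\<close> and \<open>y\<close> lie in different parts,
      \<open>z\<close> is at distance \<open>D\<close> from one of them. If they lie in one part and
      \<open>z\<close> in the other, the right-hand side is \<open>D\<close>, which exceeds
      \<open>d x y\<close>.\<close>
    show "d x y \<le> max (d x z) (d z y)"
      using * z disj[of x] disj[of y] disj[of z] uY uZ dY[of x y] dZ[of x y]
      by (auto simp: d_def)
  qed blast
  have j: "join D X Y Z'"
    unfolding join_def using X Z'(2) by (auto simp: d_def)
  have s: "spectrum X = insert D (spectrum Y \<union> spectrum Z)"
    using join_spectrum[OF j Y(2) nZ'] sZ' by simp
  have f: "finite (spectrum Y)" "finite (spectrum Z)"
    using finite_spectrum Y' fZ' sZ' by metis+
  \<comment> \<open>The overlap of the two spectra in 0 costs one distance, and the new distance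
    \<open>D\<close> makes up for it, so distances and points remain equally many.\<close>
  have "card (spectrum X) = Suc (card (spectrum Y \<union> spectrum Z))"
    unfolding s using D f by (subst card_insert_disjoint) auto
  also have "\<dots> = card (mspace X)"
    using card_Un_Int[OF f] i Y' fZ' sZ' join_card[OF j] X(1) by simp
  finally have "X \<in> \<UU>" using X Y' fZ' by (simp add: \<UU>_def)
  then show thesis using that Z'(1) j s by blast
qed

section \<open>Isometries between joins\<close>

text \<open>Isometries of the parts can be glued, because mixed pairs have distance \<open>D\<close>
  on both sides.\<close>

lemma join_isometricI:
  assumes j: "join D X Y Z" "join D X' Y' Z'" and i: "isometric Y Y'" "isometric Z Z'"
  shows "isometric X X'"
proof -
  obtain \<Phi> where \<Phi>: "bij_betw \<Phi> (mspace Y) (mspace Y')"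
    "\<And>x y. x\<in>mspace Y \<Longrightarrow> y\<in>mspace Y \<Longrightarrow> mdist Y x y = mdist Y' (\<Phi> x) (\<Phi> y)"
    using i unfolding isometric_def by blast
  obtain \<Psi> where \<Psi>: "bij_betw \<Psi> (mspace Z) (mspace Z')"
    "\<And>x y. x\<in>mspace Z \<Longrightarrow> y\<in>mspace Z \<Longrightarrow> mdist Z x y = mdist Z' (\<Psi> x) (\<Psi> y)"
    using i unfolding isometric_def by blast
  define h where "h x = (if x \<in> mspace Y then \<Phi> x else \<Psi> x)" for x
  have hY: "h x = \<Phi> x" "\<Phi> x \<in> mspace Y'" if "x \<in> mspace Y" for x
    using that bij_betw_apply[OF \<Phi>(1)] by (auto simp: h_def)
  have hZ: "h x = \<Psi> x" "\<Psi> x \<in> mspace Z'" if "x \<in> mspace Z" for x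
    using that bij_betw_apply[OF \<Psi>(1)] j(1) by (auto simp: h_def join_def)
  have "bij_betw h (mspace Y) (mspace Y')" "bij_betw h (mspace Z) (mspace Z')"
    using \<Phi>(1) \<Psi>(1) hY hZ by (simp_all cong: bij_betw_cong)
  then have "bij_betw h (mspace X) (mspace X')"
    using j by (auto simp: join_def intro: bij_betw_combine)
  moreover have "mdist X x y = mdist X' (h x) (h y)" if "x \<in> mspace X" "y \<in> mspace X" for x y
  proof -
    have "mdist X x y = D" "mdist X' (h x) (h y) = D" if "x \<in> mspace Z" "y \<in> mspace Y"
      using that j hY hZ mdist_commute[of X x y] mdist_commute[of X' "h x" "h y"]
      by (simp_all add: join_def)
    then show ?thesis
      using that j hY hZ \<Phi>(2) \<Psi>(2) by (auto simp: join_def)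
  qed
  ultimately show ?thesis unfolding isometric_def by blast
qed

text \<open>Formulated for the first part; \<open>join_commute\<close> transfers it to the
  second.\<close>

lemma restrict_isometric:
  assumes "join D X Y Z" "join D X' Y' Z'" "bij_betw \<Phi> (mspace X) (mspace X')"
    "\<And>x y. x \<in> mspace X \<Longrightarrow> y \<in> mspace X \<Longrightarrow> mdist X x y = mdist X' (\<Phi> x) (\<Phi> y)"
    "\<Phi> ` mspace Y = mspace Y'"
  shows "isometric Y Y'"
proof -
  have "bij_betw \<Phi> (mspace Y) (mspace Y')"
    using assms(1,3,5) by (auto simp: join_def bij_betw_def inj_on_Un)
  moreover have "mdist Y x y = mdist Y' (\<Phi> x) (\<Phi> y)" if "x \<in> mspace Y" "y \<in> mspace Y" for x y
  proof -
    have "\<Phi> x \<in> mspace Y'" "\<Phi> y \<in> mspace Y'" using that assms(5) by auto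
    then show ?thesis using that assms(1,2) assms(4)[of x y] by (simp add: join_def)
  qed
  ultimately show ?thesis unfolding isometric_def by blast
qed

text \<open>The distance \<^term>\<open>s\<close> tells the two parts of a join apart.\<close>

lemma join_isometricD:
  assumes j: "join D X Y Z" "join D X' Y' Z'" and i: "isometric X X'"
    and s: "s \<in> spectrum Y" "s \<notin> spectrum Z'"
    and Y: "\<And>r. r \<in> spectrum Y \<Longrightarrow> r < D" and Y': "\<And>r. r \<in> spectrum Y' \<Longrightarrow> r < D"
  shows "isometric Y Y'" "isometric Z Z'"
proof -
  obtain \<Phi> where \<Phi>: "bij_betw \<Phi> (mspace X) (mspace X')"
    "\<And>x y. x\<in>mspace X \<Longrightarrow> y\<in>mspace X \<Longrightarrow> mdist X x y = mdist X' (\<Phi> x) (\<Phi> y)"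
    using i unfolding isometric_def by blast
  obtain p q where pq: "p \<in> mspace Y" "q \<in> mspace Y" "mdist Y p q = s"
    using s by (auto simp: spectrum_def)
  have X: "mspace X = mspace Y \<union> mspace Z" "mspace Y \<inter> mspace Z = {}"
    and X': "mspace X' = mspace Y' \<union> mspace Z'" "mspace Y' \<inter> mspace Z' = {}"
    using j by (auto simp: join_def)
  \<comment> \<open>A part with all its distances below \<open>D\<close> is the open ball of radius
    \<open>D\<close> about each of its points, so one point of it recovers the whole part from the
    metric.\<close>
  have ball: "y \<in> mspace Y \<longleftrightarrow> mdist X a y < D" if "a \<in> mspace Y" "y \<in> mspace X" for a y
    using that j(1) Y mdist_in_spectrum[of a Y y] by (auto simp: join_def)
  have ball': "y \<in> mspace Y' \<longleftrightarrow> mdist X' a y < D" if "a \<in> mspace Y'" "y \<in> mspace X'" for a y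
    using that j(2) Y' mdist_in_spectrum[of a Y' y] by (auto simp: join_def)
  have \<Phi>in: "\<Phi> x \<in> mspace X'" if "x \<in> mspace X" for x
    using bij_betw_apply[OF \<Phi>(1) that] .
  have ds: "mdist X' (\<Phi> p) (\<Phi> q) = s"
    using pq \<Phi>(2)[of p q] X j(1) by (auto simp: join_def)
  \<comment> \<open>The images of \<open>p\<close> and \<open>q\<close> have distance
    \<open>s < D\<close>, so they lie in a common part, and this cannot be \<open>Z'\<close>, where
    \<open>s\<close> does not occur.\<close>
  have "\<Phi> p \<in> mspace Y'"
  proof (rule ccontr)
    assume "\<Phi> p \<notin> mspace Y'"
    then have p: "\<Phi> p \<in> mspace Z'" using \<Phi>in[of p] pq X X' by auto
    moreover have "\<Phi> q \<notin> mspace Z'"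
      using ds p j(2) s(2) mdist_in_spectrum[of "\<Phi> p" Z' "\<Phi> q"] by (auto simp: join_def)
    then have "\<Phi> q \<in> mspace Y'" using \<Phi>in[of q] pq X X' by auto
    ultimately have "mdist X' (\<Phi> p) (\<Phi> q) = D"
      using j(2) mdist_commute[of X' "\<Phi> p" "\<Phi> q"] by (simp add: join_def)
    then show False using ds Y[OF s(1)] by simp
  qed
  then have *: "x \<in> mspace Y \<longleftrightarrow> \<Phi> x \<in> mspace Y'" if "x \<in> mspace X" for x
    using ball[of p x] ball'[of "\<Phi> p" "\<Phi> x"] \<Phi>(2)[of p x] \<Phi>in pq(1) X that by auto
  have sur: "\<Phi> ` mspace X = mspace X'" using \<Phi>(1) by (simp add: bij_betw_def)
  have im: "\<Phi> ` {x \<in> mspace X. \<Phi> x \<in> B} = B" if "B \<subseteq> mspace X'" for B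
    using that sur by auto
  have "mspace Y = {x \<in> mspace X. \<Phi> x \<in> mspace Y'}" using * X by auto
  then have 1: "\<Phi> ` mspace Y = mspace Y'" using im[of "mspace Y'"] X' by auto
  have "mspace Z = {x \<in> mspace X. \<Phi> x \<in> mspace Z'}" using * X X' \<Phi>in by blast
  then have 2: "\<Phi> ` mspace Z = mspace Z'" using im[of "mspace Z'"] X' by auto
  show "isometric Y Y'" using restrict_isometric[OF j \<Phi> 1] .
  show "isometric Z Z'" using restrict_isometric[OF join_commute[OF j(1)] join_commute[OF j(2)] \<Phi> 2] .
qed

section \<open>Isometry classes as triples of a distance set and two smaller classes\<close>

lemma card_classes_split:
  fixes S :: "real set"
  assumes fin: "finite S" and 0: "0 \<in> S" and s: "s \<in> S" "s \<noteq> 0" "s \<noteq> D"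
    and D: "D \<in> S" and D0: "D \<noteq> 0"
    and Dmax: "\<And>r. r \<in> S \<Longrightarrow> r \<noteq> D \<Longrightarrow> r < D"
  shows "card (classes S :: 'a::infinite metric set set) =
    card (SIGMA T : Pow (S - {0, D, s}).
      (classes (insert 0 (insert s T)) :: 'a metric set set) \<times> (classes (S - {D, s} - T) :: 'a metric set set))"
    (is "_ = card ?C")
proof -
  have maxS: "Max S = D"
    using fin D Dmax by (intro Max_eqI) (auto simp: less_eq_real_def)
  show ?thesis
    unfolding classes_def[of S]
  proof (rule card_quotient_eqI[OF equiv_isometry_rel,
        where R = "\<lambda>X (T, y, z). \<exists>Y\<in>y. \<exists>Z\<in>z. join D X Y Z"])
    fix X :: "'a metric" assume X: "X \<in> spaces S"
    then have U: "X \<in> \<UU>" and sX: "spectrum X = S" by (auto simp: spaces_def)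
    \<comment> \<open>Two different distances force at least two points, so \<open>X\<close> can be
      split.\<close>
    have "card {0, s} \<le> card S" using fin 0 s by (intro card_mono) auto
    then have "card (mspace X) \<ge> 2" using U sX s by (simp add: \<UU>_def)
    then obtain Y0 Z0 where j: "join D X Y0 Z0" and YZ: "Y0 \<in> \<UU>" "Z0 \<in> \<UU>"
      "mspace Y0 \<noteq> {}" "mspace Z0 \<noteq> {}" "spectrum Y0 \<inter> spectrum Z0 = {0}"
      "D \<notin> spectrum Y0 \<union> spectrum Z0"
      using UU_split[OF U] unfolding sX maxS by metis
    have "S = insert D (spectrum Y0 \<union> spectrum Z0)"
      using join_spectrum[OF j YZ(3,4)] sX by simp
    \<comment> \<open>The splitting does not order its parts; they are swapped if necessary so that
      \<open>Y\<close> realises \<open>s\<close>.\<close>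
    then have "\<exists>Y Z. join D X Y Z \<and> Y \<in> \<UU> \<and> Z \<in> \<UU> \<and> spectrum Y \<inter> spectrum Z = {0} \<and>
      D \<notin> spectrum Y \<union> spectrum Z \<and> S = insert D (spectrum Y \<union> spectrum Z) \<and> s \<in> spectrum Y"
    proof (cases "s \<in> spectrum Y0")
      case True
      then show ?thesis using j YZ \<open>S = _\<close> by blast
    next
      case False
      then have "s \<in> spectrum Z0" using \<open>S = _\<close> s by auto
      then show ?thesis using join_commute[OF j] YZ \<open>S = _\<close> by (metis Int_commute Un_commute)
    qed
    then obtain Y Z where *: "join D X Y Z" "Y \<in> \<UU>" "Z \<in> \<UU>" "spectrum Y \<inter> spectrum Z = {0}"
      "D \<notin> spectrum Y \<union> spectrum Z" "S = insert D (spectrum Y \<union> spectrum Z)" "s \<in> spectrum Y"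
      by blast
    let ?T = "spectrum Y - {0, s}"
    have z: "0 \<in> spectrum Y" "0 \<in> spectrum Z" using *(4) by auto
    have "Y \<in> spaces (insert 0 (insert s ?T))"
      using * z by (auto simp: spaces_def)
    then obtain y where y: "y \<in> classes (insert 0 (insert s ?T))" "Y \<in> y" using ex_class by blast
    have "spectrum Z = S - {D, s} - ?T"
      using * s z D0 by auto
    then have "Z \<in> spaces (S - {D, s} - ?T)"
      using * by (simp add: spaces_def)
    then obtain z where z': "z \<in> classes (S - {D, s} - ?T)" "Z \<in> z" using ex_class by blast
    have "?T \<in> Pow (S - {0, D, s})" using * by auto
    then have "(?T, y, z) \<in> ?C" using y(1) z'(1) by (intro SigmaI)
    then show "\<exists>c\<in>?C. case c of (T, y, z) \<Rightarrow> \<exists>Y\<in>y. \<exists>Z\<in>z. join D X Y Z"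
      by (rule bexI[rotated]) (use *(1) y(2) z'(2) in blast)
  next
    fix c assume "c \<in> ?C"
    obtain T y z where c: "c = (T, y, z)" by (cases c)
    have T: "T \<subseteq> S - {0, D, s}"
      and y: "y \<in> classes (insert 0 (insert s T))" and z: "z \<in> classes (S - {D, s} - T)"
      using \<open>c \<in> ?C\<close> unfolding c by simp_all
    obtain Y where Y: "Y \<in> y" "Y \<in> spaces (insert 0 (insert s T))" using classes_ex_member[OF y] by blast
    obtain Z where Z: "Z \<in> z" "Z \<in> spaces (S - {D, s} - T)" using classes_ex_member[OF z] by blast
    have sp: "spectrum Y = insert 0 (insert s T)" "spectrum Z = S - {D, s} - T"
      and U: "Y \<in> \<UU>" "Z \<in> \<UU>" using Y Z by (auto simp: spaces_def)
    have ne: "mspace Y \<noteq> {}" "mspace Z \<noteq> {}"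
      unfolding zero_in_spectrum_iff[symmetric] sp using 0 T s D0 by auto
    have i: "spectrum Y \<inter> spectrum Z = {0}" unfolding sp using 0 T s D0 by auto
    have lt: "r < D" if "r \<in> spectrum Y \<union> spectrum Z" for r
      using that Dmax T s 0 D0 unfolding sp by auto
    obtain X Z' where X: "isometric Z Z'" "join D X Y Z'" "X \<in> \<UU>"
      "spectrum X = insert D (spectrum Y \<union> spectrum Z)"
      by (rule ex_join[OF U(1) ne(1) U(2) ne(2) i lt])
    have "spectrum X = S" unfolding X(4) sp using 0 s D T by auto
    then have "X \<in> spaces S" using X by (simp add: spaces_def)
    \<comment> \<open>The join was formed with a moved copy of \<open>Z\<close>, which still
      represents the class \<open>z\<close>.\<close>
    moreover have "Z' \<in> z" using classes_isometric[OF z Z(1) X(1)] isometric_spaces[OF X(1) Z(2)] .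
    ultimately show "\<exists>X\<in>spaces S. case c of (T, y, z) \<Rightarrow> \<exists>Y\<in>y. \<exists>Z\<in>z. join D X Y Z"
      using X(2) Y(1) c by auto
  next
    fix X X' :: "'a metric" and c c'
    assume X: "X \<in> spaces S" "X' \<in> spaces S" and cc: "c \<in> ?C" "c' \<in> ?C"
      and R: "case c of (T, y, z) \<Rightarrow> \<exists>Y\<in>y. \<exists>Z\<in>z. join D X Y Z"
        "case c' of (T, y, z) \<Rightarrow> \<exists>Y\<in>y. \<exists>Z\<in>z. join D X' Y Z"
    obtain T y z where c: "c = (T, y, z)" by (cases c)
    have T: "T \<subseteq> S - {0, D, s}"
      and y: "y \<in> classes (insert 0 (insert s T))" and z: "z \<in> classes (S - {D, s} - T)"
      using cc(1) unfolding c by simp_all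
    obtain T' y' z' where c': "c' = (T', y', z')" by (cases c')
    have T': "T' \<subseteq> S - {0, D, s}"
      and y': "y' \<in> classes (insert 0 (insert s T'))" and z': "z' \<in> classes (S - {D, s} - T')"
      using cc(2) unfolding c' by simp_all
    obtain Y Z where Y: "Y \<in> y" "Z \<in> z" and j: "join D X Y Z" using R c by auto
    obtain Y' Z' where Y': "Y' \<in> y'" "Z' \<in> z'" and j': "join D X' Y' Z'" using R c' by auto
    have sp: "spectrum Y = insert 0 (insert s T)"
      and sp': "spectrum Y' = insert 0 (insert s T')" "spectrum Z' = S - {D, s} - T'"
      using classes_member Y y Y' y' z' unfolding spaces_def by blast+
    have lt: "r < D" if "r \<in> spectrum Y" for r
      using that Dmax T s 0 D0 unfolding sp by auto
    have lt': "r < D" if "r \<in> spectrum Y'" for r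
      using that Dmax T' s 0 D0 unfolding sp' by auto
    \<comment> \<open>This prevents an isometry from exchanging the marked part with the unmarked
      one.\<close>
    have ss: "s \<in> spectrum Y" "s \<notin> spectrum Z'" by (auto simp: sp sp')
    have "isometric X X' \<longleftrightarrow> c = c'"
    proof
      assume i: "isometric X X'"
      have iY: "isometric Y Y'" and iZ: "isometric Z Z'"
        using join_isometricD[OF j j' i ss lt lt'] by auto
      have "insert 0 (insert s T) = insert 0 (insert s T')"
        using isometric_spectrum[OF iY] sp sp' by simp
      \<comment> \<open>Neither set contains 0 or \<open>s\<close>, so each can be read off from the
        spectrum of the marked part.\<close>
      then have TT: "T = T'" using T T' by auto
      then show "c = c'"
        using c c' iY iZ classes_eq_iff[of y _ y' Y Y'] classes_eq_iff[of z _ z' Z Z'] y y' z z' Y Y' by auto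
    next
      assume "c = c'"
      then have "isometric Y Y'" "isometric Z Z'"
        using c c' classes_eq_iff[of y _ y' Y Y'] classes_eq_iff[of z _ z' Z Z'] y z Y Y' by auto
      then show "isometric X X'" using join_isometricI[OF j j'] by blast
    qed
    then show "(X, X') \<in> isometry_rel (spaces S) \<longleftrightarrow> c = c'"
      using X by (simp add: isometry_rel_def)
  qed
qed

section \<open>Sums over subsets and binomial coefficients\<close>

text \<open>Subsets of equal size contribute equally, and grouping them by size produces the
  binomial coefficients.\<close>

lemma sum_Pow_card:
  fixes f :: "nat \<Rightarrow> nat"
  assumes "finite A"
  shows "(\<Sum>T\<in>Pow A. f (card T)) = (\<Sum>j\<le>card A. (card A choose j) * f j)"
proof -
  have "(\<Sum>T\<in>Pow A. f (card T)) = (\<Sum>j\<le>card A. \<Sum>T\<in>{T \<in> Pow A. card T = j}. f (card T))"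
    using assms by (intro sum.group[symmetric]) (auto intro: card_mono)
  also have "\<dots> = (\<Sum>j\<le>card A. (card A choose j) * f j)"
  proof (rule sum.cong)
    fix j
    have "(\<Sum>T\<in>{T \<in> Pow A. card T = j}. f (card T)) = card {T. T \<subseteq> A \<and> card T = j} * f j"
      by (simp add: Pow_def)
    then show "(\<Sum>T\<in>{T \<in> Pow A. card T = j}. f (card T)) = (card A choose j) * f j"
      using n_subsets[OF assms] by simp
  qed simp
  finally show ?thesis .
qed

section \<open>One-point and two-point spaces\<close>

text \<open>The witness \<open>X\<close> excludes the empty quotient, which would have cardinality
  0.\<close>

lemma kappa_eq_1I:
  fixes X :: "'a::infinite metric"
  assumes "X \<in> \<UU>_card n" and "\<And>(X :: 'a metric) (Y :: 'a metric). X \<in> \<UU>_card n \<Longrightarrow> Y \<in> \<UU>_card n \<Longrightarrow> weakly_similar X Y"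
  shows "kappa TYPE('a) n = 1"
proof -
  have "card ((\<UU>_card n :: 'a metric set) // weak_similarity_rel (\<UU>_card n)) = card {()}"
    by (rule card_quotient_eqI[OF equiv_weak_similarity_rel, where R = "\<lambda>_ _. True"])
      (use assms in \<open>auto simp: weak_similarity_rel_def\<close>)
  then show ?thesis by (simp add: kappa_def)
qed

lemma one_point_spaces:
  fixes X :: "'a metric"
  assumes "mspace X = {a}"
  shows "spectrum X = {0}" "X \<in> \<UU>"
proof -
  show s: "spectrum X = {0}"
    using assms by (auto simp: spectrum_def)
  show "X \<in> \<UU>" using assms s by (auto simp: \<UU>_def ultrametric_def)
qed

lemma ex_one_point_space: "\<exists>X :: 'a metric. mspace X = {a}"
proof -
  obtain X :: "'a metric" where "mspace X = {a}"
    by (rule obtain_ultrametric[of "{a}" "\<lambda>_ _. 0"]) auto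
  then show ?thesis by blast
qed

lemma kappa_1: "kappa TYPE('a::infinite) 1 = 1"
proof -
  obtain X :: "'a metric" where X: "mspace X = {undefined}" using ex_one_point_space[of undefined] ..
  show ?thesis
  proof (rule kappa_eq_1I)
    show "X \<in> \<UU>_card 1" using one_point_spaces[OF X] X by (simp add: \<UU>_card_def)
    fix Y Z :: "'a metric" assume "Y \<in> \<UU>_card 1" "Z \<in> \<UU>_card 1"
    then obtain a b where ab: "mspace Y = {a}" "mspace Z = {b}"
      by (auto simp: \<UU>_card_def card_1_singleton_iff)
    have "isometric Y Z"
      unfolding isometric_def
      by (rule exI[of _ "\<lambda>_. b"])
        (use ab in \<open>auto simp: bij_betw_def\<close>)
    then show "weakly_similar Y Z" by (rule isometric_imp_weakly_similar)
  qed
qed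

text \<open>Existence comes from joining a one-point space to a copy of itself at distance 1. For
  uniqueness both spaces are relabelled to the spectrum {0, 1}, after which the two points of each
  have distance 1.\<close>

lemma kappa_2: "kappa TYPE('a::infinite) 2 = 1"
proof -
  obtain P :: "'a metric" where P: "mspace P = {undefined}" using ex_one_point_space[of undefined] ..
  note P' = one_point_spaces[OF P]
  obtain X Q where X: "isometric P Q" "join 1 X P Q" "X \<in> \<UU>" "spectrum X = insert 1 {0}"
    using ex_join[of P P 1] P P' by (metis Un_absorb Int_absorb insert_not_empty singletonD zero_less_one)
  show ?thesis
  proof (rule kappa_eq_1I)
    show "X \<in> \<UU>_card 2" using X by (auto simp: \<UU>_card_def \<UU>_def)
    fix Y Z :: "'a metric" assume *: "Y \<in> \<UU>_card 2" "Z \<in> \<UU>_card 2"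
    have T: "{0, 1} \<subseteq> {0::real..}" "0 \<in> {0::real, 1}" "card {0::real, 1} = 2" "2 > (0::nat)" by auto
    obtain Y' Z' :: "'a metric" where Y': "Y' \<in> spaces {0, 1}" "weakly_similar Y Y'"
      and Z': "Z' \<in> spaces {0, 1}" "weakly_similar Z Z'"
      using ex_relabel[OF *(1) T] ex_relabel[OF *(2) T] by blast
    have iso: "\<exists>a b. mspace W = {a, b} \<and> a \<noteq> b \<and> mdist W a b = 1" if "W \<in> spaces {0, 1}"
      for W :: "'a metric"
    proof -
      have W: "card (mspace W) = 2" "spectrum W = {0, 1}" using that by (auto simp: spaces_def \<UU>_def)
      then obtain a b where ab: "mspace W = {a, b}" "a \<noteq> b" by (auto simp: card_2_iff)
      then have "mdist W a b \<in> {0, 1}" "mdist W a b \<noteq> 0"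
        using W mdist_in_spectrum[of a W b] mdist_eq_0_iff[of a W b] by auto
      then show ?thesis using ab by auto
    qed
    obtain a b where ab: "mspace Y' = {a, b}" "a \<noteq> b" "mdist Y' a b = 1" using iso Y' by blast
    obtain c d where cd: "mspace Z' = {c, d}" "c \<noteq> d" "mdist Z' c d = 1" using iso Z' by blast
    have "isometric Y' Z'"
      unfolding isometric_def
      by (rule exI[of _ "\<lambda>x. if x = a then c else d"])
        (use ab cd mdist_commute[of Y' a b] mdist_commute[of Z' c d] mdist_eq_0_iff[of _ Y'] mdist_eq_0_iff[of _ Z']
          in \<open>auto simp: bij_betw_def inj_on_def\<close>)
    then show "weakly_similar Y Z"
      using weakly_similar_trans[OF Y'(2)] weakly_similar_trans[OF _ weakly_similar_sym[OF Z'(2)]]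
        isometric_imp_weakly_similar by blast
  qed
qed

section \<open>The recursion for the number of spaces with a given spectrum\<close>

theorem corollary3p3:
  fixes n :: nat and S :: "real set"
  assumes "n \<ge> 3" and "S \<subseteq> {0..}" and "card S = n" and "0 \<in> S"
  shows "card ({X \<in> (\<UU>_card n :: 'a::infinite metric set). spectrum X = S}
             // isometry_rel {X \<in> \<UU>_card n. spectrum X = S})
       = (\<Sum>k = 2..n - 1. ((n - 3) choose (k - 2)) * kappa TYPE('a) k * kappa TYPE('a) (n - k))
       \<and> kappa TYPE('a) 1 = 1 \<and> kappa TYPE('a) 2 = 1"
proof (intro conjI)
  have fin: "finite S" using assms card_ge_0_finite[of S] by simp
  define D where "D = Max S"
  have D: "D \<in> S" unfolding D_def using fin assms(4) by (intro Max_in) auto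
  have Dmax: "r < D" if "r \<in> S" "r \<noteq> D" for r
    using that fin unfolding D_def by (metis Max_ge less_eq_real_def)
  \<comment> \<open>Here \<open>n \<ge> 3\<close> enters: it provides a marker \<open>s\<close>
    besides 0 and \<open>D\<close>.\<close>
  have "\<not> S \<subseteq> {0, D}"
  proof
    assume "S \<subseteq> {0, D}"
    then have "card S \<le> card {0, D}" by (intro card_mono) auto
    also have "\<dots> \<le> 2" by (simp add: card_insert_if)
    finally show False using assms by simp
  qed
  then obtain s where s: "s \<in> S" "s \<noteq> 0" "s \<noteq> D" by blast
  have D0: "D \<noteq> 0" using s assms(2) Dmax[of s] by auto
  let ?A = "S - {0, D, s}"
  have cA: "card ?A = n - 3"
    using fin s D D0 assms by (simp add: card_Diff_subset)
  \<comment> \<open>With \<open>j\<close> elements in \<open>T\<close>, the marked part has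
    \<open>j + 2\<close> distances because of 0 and \<open>s\<close>; the other part keeps those of
    the \<open>n - 2\<close> elements of \<open>S - {D, s}\<close> that are not in
    \<open>T\<close>.\<close>
  let ?f = "\<lambda>j. kappa TYPE('a) (j + 2) * kappa TYPE('a) (n - 2 - j)"
  have kT: "card ((classes (insert 0 (insert s T)) :: 'a metric set set) \<times>
      (classes (S - {D, s} - T) :: 'a metric set set)) = ?f (card T)" if "T \<in> Pow ?A" for T
  proof -
    have T: "finite T" "T \<subseteq> ?A" using that fin by (auto intro: finite_subset)
    \<comment> \<open>Hence \<open>n - 2 - card T\<close> is positive: the natural subtraction does
      not truncate, and 0 remains for the unmarked part.\<close>
    then have "card T \<le> n - 3" using card_mono[of ?A T] fin cA by simp
    have 1: "card (insert 0 (insert s T)) = card T + 2" using T s by (auto simp: card_insert_if)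
    have 2: "card (S - {D, s} - T) = n - 2 - card T"
      using T s D fin assms(3) by (subst card_Diff_subset) (auto simp: card_Diff_subset)
    have "card (classes (insert 0 (insert s T)) :: 'a metric set set) = kappa TYPE('a) (card T + 2)"
      using T s assms(2) 1 by (intro card_classes_eq_kappa) auto
    moreover have "card (classes (S - {D, s} - T) :: 'a metric set set) = kappa TYPE('a) (n - 2 - card T)"
      using T s assms 2 D0 \<open>card T \<le> n - 3\<close> by (intro card_classes_eq_kappa) auto
    ultimately show ?thesis by (simp add: card_cartesian_product)
  qed
  have "card (classes S :: 'a metric set set) =
    card (SIGMA T : Pow ?A. (classes (insert 0 (insert s T)) :: 'a metric set set) \<times>
      (classes (S - {D, s} - T) :: 'a metric set set))"
    using card_classes_split[OF fin assms(4) s D D0 Dmax] .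
  also have "\<dots> = (\<Sum>T\<in>Pow ?A. ?f (card T))"
  proof (subst card_SigmaI)
    have "finite (classes (insert 0 (insert s T)) :: 'a metric set set)"
      "finite (classes (S - {D, s} - T) :: 'a metric set set)" if "T \<in> Pow ?A" for T
      using that fin by (auto intro!: finite_classes intro: finite_subset)
    then show "\<forall>T\<in>Pow ?A. finite ((classes (insert 0 (insert s T)) :: 'a metric set set) \<times>
      (classes (S - {D, s} - T) :: 'a metric set set))"
      by (intro ballI finite_cartesian_product)
  qed (use fin kT in \<open>auto intro!: sum.cong\<close>)
  also have "\<dots> = (\<Sum>j\<le>n - 3. ((n - 3) choose j) * ?f j)"
    using sum_Pow_card[of ?A ?f] fin cA by simp
  \<comment> \<open>The new index \<open>k = j + 2\<close> is the number of points of the marked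
    part.\<close>
  also have "\<dots> = (\<Sum>k = 2..n - 1. ((n - 3) choose (k - 2)) * kappa TYPE('a) k * kappa TYPE('a) (n - k))"
    by (rule sum.reindex_bij_witness[of _ "\<lambda>k. k - 2" "\<lambda>j. j + 2"]) (use assms(1) in auto)
  finally show "card ({X \<in> (\<UU>_card n :: 'a metric set). spectrum X = S}
      // isometry_rel {X \<in> \<UU>_card n. spectrum X = S})
      = (\<Sum>k = 2..n - 1. ((n - 3) choose (k - 2)) * kappa TYPE('a) k * kappa TYPE('a) (n - k))"
    using spaces_UU_card[OF assms(3), where 'a = 'a] by (simp add: classes_def)
qed (rule kappa_1 kappa_2)+

end
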